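(* For any positive integer $m$, there exists a connected chordal graph $G$ without isolated vertices such that $$\operatorname{reg}(S/\mathrm{NI}_{\mathbf{k}}(G))=\tau(G)-m,$$ where $\mathbf{k}$ is the degree-vector of $G$.
   Context: Graphs are finite and simple. Let $K$ be a field. For a graph $G$ on $[n]$ without isolated vertices, $S=K[x_1,\ldots,x_n]$; $N_G[i]$ is the closed neighborhood of $i$; $\mathbf{x}_W=\prod_{j\in W}x_j$. For $\mathbf{k}=(k_1,\ldots,k_n)$ with $1\le k_i\le\deg_G(i)+1$, the $\mathbf{k}$-neighborhood ideal is $\mathrm{NI}_{\mathbf{k}}(G)=\sum_{i=1}^n(\mathbf{x}_W: W\subseteq N_G[i],\ |W|=k_i)\subseteq S$. The degree-vector of $G$ is $\mathbf{k}=(k_1,\ldots,k_n)$ with $k_i=\deg_G(i)$ for all $i$. $\tau(G)$ is the vertex cover number of $G$ (minimum size of a vertex cover). $\operatorname{reg}$ is Castelnuovo-Mumford regularity. *)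

theory Defs
  imports Complex_Main "HOL-Library.Poly_Mapping" "HOL-Library.Set_Algebras"
begin

section \<open>Finite simple graphs on the vertex set \<open>{1..n}\<close>\<close>

type_synonym edges = "nat set set"

definition simple_graph :: "nat \<Rightarrow> edges \<Rightarrow> bool" where
  "simple_graph n E \<longleftrightarrow> (\<forall>e\<in>E. e \<subseteq> {1..n} \<and> card e = 2)"

definition neighbors :: "edges \<Rightarrow> nat \<Rightarrow> nat set" where
  "neighbors E i = {j. {i, j} \<in> E}"

definition closed_neighborhood :: "edges \<Rightarrow> nat \<Rightarrow> nat set" where
  "closed_neighborhood E i = insert i (neighbors E i)"

definition vertex_degree :: "edges \<Rightarrow> nat \<Rightarrow> nat" where
  "vertex_degree E i = card (neighbors E i)"

definition no_isolated_vertices :: "nat \<Rightarrow> edges \<Rightarrow> bool" where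
  "no_isolated_vertices n E \<longleftrightarrow> (\<forall>i\<in>{1..n}. neighbors E i \<noteq> {})"

text \<open>The graph without vertices is not considered connected.\<close>

definition connected_graph :: "nat \<Rightarrow> edges \<Rightarrow> bool" where
  "connected_graph n E \<longleftrightarrow>
     n \<ge> 1 \<and> (\<forall>u\<in>{1..n}. \<forall>v\<in>{1..n}. (u, v) \<in> {(a, b). {a, b} \<in> E}\<^sup>*)"

text \<open>A cycle is given by the list of its vertices in cyclic order (the first vertex is not
  repeated at the end).\<close>

definition is_cycle :: "edges \<Rightarrow> nat list \<Rightarrow> bool" where
  "is_cycle E vs \<longleftrightarrow>
     length vs \<ge> 3 \<and> distinct vs \<and>
     (\<forall>i<length vs. {vs ! i, vs ! (Suc i mod length vs)} \<in> E)"

definition has_chord :: "edges \<Rightarrow> nat list \<Rightarrow> bool" where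
  "has_chord E vs \<longleftrightarrow>
     (\<exists>i<length vs. \<exists>j<length vs. i \<noteq> j \<and>
        j \<noteq> Suc i mod length vs \<and> i \<noteq> Suc j mod length vs \<and> {vs ! i, vs ! j} \<in> E)"

definition chordal :: "edges \<Rightarrow> bool" where
  "chordal E \<longleftrightarrow> (\<forall>vs. is_cycle E vs \<and> length vs \<ge> 4 \<longrightarrow> has_chord E vs)"

definition vertex_cover :: "nat \<Rightarrow> edges \<Rightarrow> nat set \<Rightarrow> bool" where
  "vertex_cover n E C \<longleftrightarrow> C \<subseteq> {1..n} \<and> (\<forall>e\<in>E. e \<inter> C \<noteq> {})"

definition vertex_cover_number :: "nat \<Rightarrow> edges \<Rightarrow> nat" where
  "vertex_cover_number n E = Min (card ` {C. vertex_cover n E C})"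


section \<open>The polynomial ring \<open>S = K[x\<^sub>1, \<dots>, x\<^sub>n]\<close>\<close>

text \<open>Monomials are finitely supported exponent vectors, polynomials finitely supported
  coefficient functions on monomials.  The type provides a variable for every natural number;
  the ring \<open>S\<close> is the subring \<open>poly_ring n\<close> of polynomials in the variables \<open>1, \<dots>, n\<close>.\<close>

type_synonym monomial = "nat \<Rightarrow>\<^sub>0 nat"
type_synonym 'k mpoly = "monomial \<Rightarrow>\<^sub>0 'k"

definition monomial_degree :: "monomial \<Rightarrow> nat" where
  "monomial_degree t = (\<Sum>v\<in>Poly_Mapping.keys t. Poly_Mapping.lookup t v)"

definition var :: "nat \<Rightarrow> 'k::field mpoly" where
  "var i = Poly_Mapping.single (Poly_Mapping.single i 1) 1"

definition var_prod :: "nat set \<Rightarrow> 'k::field mpoly" where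
  "var_prod W = (\<Prod>j\<in>W. var j)"

definition poly_ring :: "nat \<Rightarrow> 'k::field mpoly set" where
  "poly_ring n = {p. \<forall>t\<in>Poly_Mapping.keys p. Poly_Mapping.keys t \<subseteq> {1..n}}"

text \<open>The zero polynomial is homogeneous of every degree, and the only one that is homogeneous
  of a negative degree.\<close>

definition homogeneous :: "int \<Rightarrow> 'k::field mpoly \<Rightarrow> bool" where
  "homogeneous d p \<longleftrightarrow> (\<forall>t\<in>Poly_Mapping.keys p. int (monomial_degree t) = d)"

definition ideal_generated :: "nat \<Rightarrow> 'k::field mpoly set \<Rightarrow> 'k mpoly set" where
  "ideal_generated n B =
     {\<Sum>b\<in>F. q b * b | F q. finite F \<and> F \<subseteq> B \<and> (\<forall>b\<in>F. q b \<in> poly_ring n)}"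

text \<open>The sum is the elementwise sum of sets, i.e. the sum of ideals.\<close>

definition neighborhood_ideal :: "nat \<Rightarrow> edges \<Rightarrow> (nat \<Rightarrow> nat) \<Rightarrow> 'k::field mpoly set" where
  "neighborhood_ideal n E k =
     (\<Sum>i\<in>{1..n}. ideal_generated n
        {var_prod W | W. W \<subseteq> closed_neighborhood E i \<and> card W = k i})"


section \<open>Minimal graded free resolutions and regularity of \<open>S/I\<close>\<close>

text \<open>Elements of the free module \<open>S\<^sup>r\<close> are coordinate functions.\<close>

definition free_module :: "nat \<Rightarrow> nat \<Rightarrow> (nat \<Rightarrow> 'k::field mpoly) set" where
  "free_module n r = {f. (\<forall>a<r. f a \<in> poly_ring n) \<and> (\<forall>a\<ge>r. f a = 0)}"

definition mat_apply ::
  "nat \<Rightarrow> nat \<Rightarrow> (nat \<Rightarrow> nat \<Rightarrow> 'k::field mpoly) \<Rightarrow> (nat \<Rightarrow> 'k mpoly) \<Rightarrow> nat \<Rightarrow> 'k mpoly" where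
  "mat_apply r c A f = (\<lambda>a. if a < r then \<Sum>b<c. A a b * f b else 0)"

text \<open>A graded free resolution
  \<open>\<cdots> \<rightarrow> F\<^sub>2 \<rightarrow> F\<^sub>1 \<rightarrow> F\<^sub>0 \<rightarrow> S/I \<rightarrow> 0\<close>
  by finitely generated free modules, where \<open>F\<^sub>i\<close> has rank \<open>rk i\<close> and its \<open>a\<close>-th basis element
  has degree \<open>sh i a\<close>, i.e. \<open>F\<^sub>i\<close> is the direct sum of the \<open>S(-sh i a)\<close> over \<open>a < rk i\<close>.
  The differential \<open>F\<^sub>i\<^sub>+\<^sub>1 \<rightarrow> F\<^sub>i\<close> has the matrix \<open>D i\<close>; the augmentation \<open>F\<^sub>0 \<rightarrow> S/I\<close> sends the
  \<open>a\<close>-th basis element to the class of \<open>eps a\<close>.  Only entries with indices below the respective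
  ranks matter.  All maps are of degree 0.\<close>

locale graded_free_resolution =
  fixes n :: nat and I :: "'k::field mpoly set"
    and rk :: "nat \<Rightarrow> nat" and sh :: "nat \<Rightarrow> nat \<Rightarrow> int"
    and eps :: "nat \<Rightarrow> 'k mpoly" and D :: "nat \<Rightarrow> nat \<Rightarrow> nat \<Rightarrow> 'k mpoly"
  assumes eps_homogeneous:
      "a < rk 0 \<Longrightarrow> eps a \<in> poly_ring n \<and> homogeneous (sh 0 a) (eps a)"
    and D_homogeneous:
      "a < rk i \<Longrightarrow> b < rk (Suc i) \<Longrightarrow>
         D i a b \<in> poly_ring n \<and> homogeneous (sh (Suc i) b - sh i a) (D i a b)"
    and eps_surjective:
      "s \<in> poly_ring n \<Longrightarrow> \<exists>f\<in>free_module n (rk 0). s - (\<Sum>a<rk 0. f a * eps a) \<in> I"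
    and exact_0:
      "{f \<in> free_module n (rk 0). (\<Sum>a<rk 0. f a * eps a) \<in> I} =
         mat_apply (rk 0) (rk 1) (D 0) ` free_module n (rk 1)"
    and exact_Suc:
      "{f \<in> free_module n (rk (Suc i)). mat_apply (rk i) (rk (Suc i)) (D i) f = (\<lambda>_. 0)} =
         mat_apply (rk (Suc i)) (rk (Suc (Suc i))) (D (Suc i)) ` free_module n (rk (Suc (Suc i)))"

text \<open>Minimality: the image of each differential \<open>F\<^sub>i\<^sub>+\<^sub>1 \<rightarrow> F\<^sub>i\<close> lies in \<open>(x\<^sub>1, \<dots>, x\<^sub>n) F\<^sub>i\<close>.\<close>

locale minimal_graded_free_resolution = graded_free_resolution +
  assumes minimal:
    "a < rk i \<Longrightarrow> b < rk (Suc i) \<Longrightarrow> Poly_Mapping.lookup (D i a b) 0 = 0"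

text \<open>\<open>reg (S/I) = r\<close>: the maximum of \<open>j - i\<close> over all \<open>i\<close> and all degrees \<open>j\<close> of basis elements
  of \<open>F\<^sub>i\<close> is \<open>r\<close>, where \<open>F\<close> is a minimal graded free resolution of \<open>S/I\<close>.  Minimal graded free
  resolutions are unique up to isomorphism, so for homogeneous \<open>I \<noteq> S\<close> there is exactly one
  such \<open>r\<close>; for \<open>I = S\<close> there is none (the regularity of the zero module is minus infinity).\<close>

definition has_regularity :: "nat \<Rightarrow> 'k::field mpoly set \<Rightarrow> int \<Rightarrow> bool" where
  "has_regularity n I r \<longleftrightarrow>
     (\<exists>rk sh eps D. minimal_graded_free_resolution n I rk sh eps D \<and>
        (\<exists>i. \<exists>a<rk i. sh i a - int i = r) \<and>
        (\<forall>i. \<forall>a<rk i. sh i a - int i \<le> r))"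

end

theory Submission
  imports Defs
begin

text \<open>
  Attach a pendant edge to every vertex of the complete graph on \<open>m\<close> vertices.  A leaf has degree
  one, so for the degree vector it contributes the single variables of its closed neighborhood,
  that is, its own variable and that of the clique vertex it hangs on.  The leaves together
  thereby contribute all \<open>2m\<close> variables, and as no generator is constant, the ideal is the
  homogeneous maximal ideal \<open>(x\<^sub>1, \<dots>, x\<^sub>2\<^sub>m)\<close>.  Hence \<open>S/NI\<close> is the residue field, whose
  regularity is \<open>0\<close>.  The vertex cover number is \<open>m\<close>: the clique vertices form a cover, and the
  \<open>m\<close> pendant edges are a matching.  The graph is chordal because a cycle cannot pass through a
  leaf and therefore stays in the clique.

  That the residue field has regularity \<open>0\<close> is read off from the Koszul complex of the
  variables, whose \<open>i\<close>-th module is generated in degree \<open>i\<close>.  Its exactness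
  (\<open>koszul_diff_homotopy\<close>) is multigraded: in the multidegree \<open>u\<close> the complex is the augmented
  simplicial chain complex of the full simplex on the support of \<open>u\<close>, and for \<open>u \<noteq> 0\<close> it is
  contracted by the cone construction with apex the least vertex of the support.  The same
  homotopy writes a polynomial without constant term as a combination of the variables.
  The complex is first treated with chains indexed by vertex sets (\<open>koszul_diff\<close>); an enumeration
  of the \<open>i\<close>-subsets of \<open>{1..n}\<close> then turns it into a sequence of matrices (\<open>koszul_resolution\<close>).
\<close>

section \<open>Coefficients of polynomials\<close>

abbreviation exponent :: "nat \<Rightarrow> monomial" where
  "exponent v \<equiv> Poly_Mapping.single v 1"

lemma keys_add_exponent: "Poly_Mapping.keys (t + exponent v) = insert v (Poly_Mapping.keys t)"
  by (auto simp: in_keys_iff lookup_add lookup_single when_def split: if_splits)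

lemma minus_exponent_add:
  "v \<in> Poly_Mapping.keys t \<Longrightarrow> t - exponent v + exponent v = t"
  by (rule poly_mapping_eqI) (auto simp: lookup_add lookup_minus lookup_single when_def in_keys_iff)

lemma keys_minus_exponent:
  "Poly_Mapping.keys (t - exponent v) \<subseteq> Poly_Mapping.keys t"
  "Poly_Mapping.keys t - {v} \<subseteq> Poly_Mapping.keys (t - exponent v)"
  by (auto simp: in_keys_iff lookup_minus lookup_single when_def split: if_splits)

lemma lookup_var_times:
  "Poly_Mapping.lookup (var v * p) t =
     (if v \<in> Poly_Mapping.keys t then Poly_Mapping.lookup p (t - exponent v) else 0)"
proof -
  have "Poly_Mapping.lookup (var v * p) t =
    (\<Sum>l. (\<Sum>q. Poly_Mapping.lookup p q when t = l + q) when exponent v = l)"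
    unfolding var_def lookup_mult lookup_single by (simp add: when_mult)
  also have "\<dots> = (\<Sum>q. Poly_Mapping.lookup p q when t = exponent v + q)"
    by simp
  also have "\<dots> = (if v \<in> Poly_Mapping.keys t then Poly_Mapping.lookup p (t - exponent v) else 0)"
  proof (cases "v \<in> Poly_Mapping.keys t")
    case True
    have "t = exponent v + q \<longleftrightarrow> q = t - exponent v" for q
      using minus_exponent_add[OF True] by (metis add.commute add_diff_cancel_left')
    then show ?thesis using True by simp
  next
    case False
    have "t \<noteq> exponent v + q" for q
      using False keys_add_exponent[of q v] by (auto simp: add.commute)
    then show ?thesis using False by simp
  qed
  finally show ?thesis .
qed

lemma lookup_var_0: "Poly_Mapping.lookup (var v) 0 = 0"
  using lookup_var_times[of v 1 0] by simp

lemma poly_ring_iff: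
  "p \<in> poly_ring n \<longleftrightarrow> (\<forall>t. Poly_Mapping.lookup p t \<noteq> 0 \<longrightarrow> Poly_Mapping.keys t \<subseteq> {1..n})"
  by (auto simp: poly_ring_def in_keys_iff)

lemma poly_ring_0: "0 \<in> poly_ring n"
  by (simp add: poly_ring_iff)

lemma poly_ring_1: "1 \<in> poly_ring n"
  by (auto simp: poly_ring_iff lookup_one when_def)

lemma poly_ring_add: "p \<in> poly_ring n \<Longrightarrow> q \<in> poly_ring n \<Longrightarrow> p + q \<in> poly_ring n"
  using keys_add[of p q] unfolding poly_ring_def by blast

lemma poly_ring_uminus: "p \<in> poly_ring n \<Longrightarrow> - p \<in> poly_ring n"
  by (auto simp: poly_ring_iff)

lemma poly_ring_sum: "(\<And>a. a \<in> A \<Longrightarrow> f a \<in> poly_ring n) \<Longrightarrow> sum f A \<in> poly_ring n"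
  by (induction A rule: infinite_finite_induct) (auto intro: poly_ring_0 poly_ring_add)

lemma poly_ring_times:
  assumes "p \<in> poly_ring n" "q \<in> poly_ring n"
  shows "p * q \<in> poly_ring n"
  unfolding poly_ring_def
proof (rule CollectI, rule ballI)
  fix t assume "t \<in> Poly_Mapping.keys (p * q)"
  then obtain a b where "t = a + b" "a \<in> Poly_Mapping.keys p" "b \<in> Poly_Mapping.keys q"
    using keys_mult by blast
  then show "Poly_Mapping.keys t \<subseteq> {1..n}"
    using assms keys_add[of a b] unfolding poly_ring_def by blast
qed

lemma var_in_poly_ring: "v \<in> {1..n} \<Longrightarrow> var v \<in> poly_ring n"
  by (auto simp: poly_ring_def var_def)

lemma homogeneous_0: "homogeneous d 0"
  by (simp add: homogeneous_def)

lemma homogeneous_add: "homogeneous d p \<Longrightarrow> homogeneous d q \<Longrightarrow> homogeneous d (p + q)"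
  using keys_add[of p q] by (auto simp: homogeneous_def)

lemma homogeneous_uminus: "homogeneous d p \<Longrightarrow> homogeneous d (- p)"
  by (auto simp: homogeneous_def in_keys_iff)

lemma homogeneous_sum: "(\<And>a. a \<in> A \<Longrightarrow> homogeneous d (f a)) \<Longrightarrow> homogeneous d (sum f A)"
  by (induction A rule: infinite_finite_induct) (auto intro: homogeneous_0 homogeneous_add)

lemma homogeneous_var: "homogeneous 1 (var v)"
  by (simp add: homogeneous_def var_def monomial_degree_def)

section \<open>The Koszul complex of the variables\<close>

definition koszul_sign :: "nat \<Rightarrow> nat set \<Rightarrow> 'a::comm_ring_1" where
  "koszul_sign v U = (-1) ^ card {u \<in> U. u < v}"

text \<open>A chain assigns to a set \<open>W\<close> the coefficient of the basis element \<open>e\<^sub>W\<close>, in all homological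
  degrees at once.  The usual differential sends \<open>e\<^sub>W\<close> to the signed sum of the \<open>x\<^sub>v e\<^sub>W\<^sub>-\<^sub>v\<close>; the
  formula below is its coefficient at \<open>e\<^sub>U\<close>, which collects the sets \<open>W\<close> with one more element.\<close>

definition koszul_diff :: "nat \<Rightarrow> (nat set \<Rightarrow> 'k::field mpoly) \<Rightarrow> nat set \<Rightarrow> 'k mpoly" where
  "koszul_diff n f U = (\<Sum>v\<in>{1..n} - U. koszul_sign v U * (var v * f (insert v U)))"

lemma lookup_koszul_sign_times:
  "Poly_Mapping.lookup (koszul_sign v U * p) t = koszul_sign v U * Poly_Mapping.lookup p t"
  for p :: "'k::field mpoly"
  by (simp add: koszul_sign_def minus_one_power_iff)

lemma koszul_sign_times_poly_ring:
  "p \<in> poly_ring n \<Longrightarrow> koszul_sign v U * p \<in> poly_ring n" for p :: "'k::field mpoly"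
  by (simp add: koszul_sign_def minus_one_power_iff poly_ring_uminus)

lemma koszul_sign_times_homogeneous:
  "homogeneous d p \<Longrightarrow> homogeneous d (koszul_sign v U * p)" for p :: "'k::field mpoly"
  by (simp add: koszul_sign_def minus_one_power_iff homogeneous_uminus)

lemma koszul_sign_insert:
  assumes "finite U" "w \<notin> U"
  shows "koszul_sign v (insert w U) = (if w < v then - koszul_sign v U else koszul_sign v U)"
proof (cases "w < v")
  case True
  then have "{u \<in> insert w U. u < v} = insert w {u \<in> U. u < v}" by auto
  then show ?thesis using True assms by (simp add: koszul_sign_def)
next
  case False
  then have "{u \<in> insert w U. u < v} = {u \<in> U. u < v}" by auto
  then show ?thesis using False by (simp add: koszul_sign_def)
qed

lemma koszul_sign_below: "(\<And>u. u \<in> U \<Longrightarrow> v < u) \<Longrightarrow> koszul_sign v U = 1"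
proof -
  assume "\<And>u. u \<in> U \<Longrightarrow> v < u"
  then have "{u \<in> U. u < v} = {}" by fastforce
  then show ?thesis unfolding koszul_sign_def by (simp only: card.empty power_0)
qed

lemma lookup_koszul_diff:
  fixes f :: "nat set \<Rightarrow> 'k::field mpoly"
  shows "Poly_Mapping.lookup (koszul_diff n f U) t =
    (\<Sum>v\<in>{1..n} - U. koszul_sign v U *
      (if v \<in> Poly_Mapping.keys t then Poly_Mapping.lookup (f (insert v U)) (t - exponent v) else 0))"
  by (simp add: koszul_diff_def lookup_sum lookup_koszul_sign_times lookup_var_times)

lemma koszul_diff_poly_ring:
  assumes "U \<subseteq> {1..n}" "\<And>W. W \<subseteq> {1..n} \<Longrightarrow> f W \<in> poly_ring n"
  shows "koszul_diff n f U \<in> poly_ring n"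
  unfolding koszul_diff_def using assms
  by (intro poly_ring_sum koszul_sign_times_poly_ring poly_ring_times var_in_poly_ring) auto

lemma koszul_diff_cong:
  "(\<And>v. v \<in> {1..n} - U \<Longrightarrow> f (insert v U) = g (insert v U)) \<Longrightarrow>
     koszul_diff n f U = koszul_diff n g U"
  by (simp add: koszul_diff_def)

text \<open>Removing two elements in either order gives the same coefficient with opposite signs.  The
  double sum is split according to the order of the two elements, so that the two halves cancel
  in every characteristic, including two.\<close>

lemma koszul_diff_diff:
  assumes "U \<subseteq> {1..n}"
  shows "koszul_diff n (koszul_diff n f) U = 0"
proof -
  define F where "F v w =
    koszul_sign v U * koszul_sign w (insert v U) * (var v * var w * f (insert w (insert v U)))" for v w
  let ?A = "{1..n} - U"
  have fU: "finite U" using assms finite_subset by blast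
  \<comment> \<open>Only the sign at the larger of the two elements notices the presence of the other one.\<close>
  have anti: "F v w = - F w v" if "v \<in> ?A" "w \<in> ?A" "v < w" for v w
  proof -
    have "koszul_sign w (insert v U) = - (koszul_sign w U :: 'a mpoly)"
      "koszul_sign v (insert w U) = (koszul_sign v U :: 'a mpoly)"
      using that by (simp_all add: koszul_sign_insert[OF fU])
    then show ?thesis by (simp add: F_def insert_commute mult.commute mult.left_commute)
  qed
  have "koszul_diff n (koszul_diff n f) U = (\<Sum>v\<in>?A. \<Sum>w\<in>{1..n} - insert v U. F v w)"
    unfolding koszul_diff_def F_def by (simp add: sum_distrib_left mult_ac)
  also have "\<dots> = (\<Sum>v\<in>?A. \<Sum>w\<in>?A. (if v < w then F v w else 0) + (if w < v then F v w else 0))"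
  proof (rule sum.cong[OF refl])
    fix v assume "v \<in> ?A"
    have "(\<Sum>w\<in>{1..n} - insert v U. F v w) =
      (\<Sum>w\<in>{1..n} - insert v U. (if v < w then F v w else 0) + (if w < v then F v w else 0))"
      by (intro sum.cong) auto
    also have "\<dots> = (\<Sum>w\<in>?A. (if v < w then F v w else 0) + (if w < v then F v w else 0))"
      by (intro sum.mono_neutral_left) auto
    finally show "(\<Sum>w\<in>{1..n} - insert v U. F v w) = \<dots>" .
  qed
  also have "\<dots> = (\<Sum>v\<in>?A. \<Sum>w\<in>?A. if v < w then F v w else 0) +
      (\<Sum>v\<in>?A. \<Sum>w\<in>?A. if w < v then F v w else 0)"
    by (simp add: sum.distrib)
  also have "(\<Sum>v\<in>?A. \<Sum>w\<in>?A. if w < v then F v w else 0) =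
      (\<Sum>w\<in>?A. \<Sum>v\<in>?A. if w < v then F v w else 0)"
    by (rule sum.swap)
  also have "\<dots> = (\<Sum>w\<in>?A. \<Sum>v\<in>?A. - (if w < v then F w v else 0))"
    by (intro sum.cong) (auto simp: anti)
  finally show ?thesis by (simp add: sum_negf)
qed

section \<open>Exactness of the Koszul complex\<close>

text \<open>Of the terms of \<open>p\<close>, only those whose least variable is \<open>x\<^sub>v\<close> are kept, and these are divided by
  \<open>x\<^sub>v\<close>.  In terms of the quotient \<open>t\<close>: it may contain \<open>v\<close> but nothing smaller.\<close>

definition least_var_quotient :: "nat \<Rightarrow> 'k::field mpoly \<Rightarrow> 'k mpoly" where
  "least_var_quotient v p = Abs_poly_mapping
     (\<lambda>t. if \<forall>u\<in>Poly_Mapping.keys t. v \<le> u then Poly_Mapping.lookup p (t + exponent v) else 0)"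

text \<open>This is the cone with apex the least vertex of the multidegree: a term \<open>x\<^sup>s e\<^sub>V\<close> whose least
  vertex \<open>v\<close> occurs in \<open>s\<close> but not in \<open>V\<close> is sent to \<open>x\<^sup>s\<^sup>-\<^sup>v e\<^sub>V\<^sub>+\<^sub>v\<close>, and every other term to \<open>0\<close>.
  In the result, \<open>v\<close> is the least element of the set, so the sign is always \<open>1\<close>.\<close>

definition koszul_homotopy :: "(nat set \<Rightarrow> 'k::field mpoly) \<Rightarrow> nat set \<Rightarrow> 'k mpoly" where
  "koszul_homotopy f W =
     (if W = {} then 0 else least_var_quotient (Min W) (f (W - {Min W})))"

lemma lookup_least_var_quotient:
  "Poly_Mapping.lookup (least_var_quotient v p) t =
     (if \<forall>u\<in>Poly_Mapping.keys t. v \<le> u then Poly_Mapping.lookup p (t + exponent v) else 0)"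
proof -
  let ?g = "\<lambda>t. if \<forall>u\<in>Poly_Mapping.keys t. v \<le> u then Poly_Mapping.lookup p (t + exponent v) else 0"
  have "{t. ?g t \<noteq> 0} \<subseteq> (\<lambda>t. t + exponent v) -` Poly_Mapping.keys p"
    by (auto simp: in_keys_iff)
  moreover have "finite ((\<lambda>t. t + exponent v) -` Poly_Mapping.keys p)"
    by (intro finite_vimageI) (auto simp: inj_def)
  ultimately have "finite {t. ?g t \<noteq> 0}" by (rule finite_subset)
  then show ?thesis unfolding least_var_quotient_def by simp
qed

lemma koszul_homotopy_poly_ring:
  assumes "W \<subseteq> {1..n}" "\<And>W. W \<subseteq> {1..n} \<Longrightarrow> f W \<in> poly_ring n"
  shows "koszul_homotopy f W \<in> poly_ring n"
proof (cases "W = {}")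
  case True then show ?thesis by (simp add: koszul_homotopy_def poly_ring_0)
next
  case False
  have "f (W - {Min W}) \<in> poly_ring n" using assms by blast
  then have "Poly_Mapping.keys t \<subseteq> {1..n}"
    if "Poly_Mapping.lookup (f (W - {Min W})) (t + exponent (Min W)) \<noteq> 0" for t
    using that keys_add_exponent unfolding poly_ring_iff by blast
  then show ?thesis
    using False by (simp add: koszul_homotopy_def poly_ring_iff lookup_least_var_quotient)
qed

text \<open>The homotopy formula \<open>dh + hd = 1\<close> holds in nonzero multidegrees, so \<open>dh f = f\<close> for a cycle \<open>f\<close>
  without component in multidegree zero.  It is checked coefficientwise.  Let \<open>m\<close> be the least
  vertex of the multidegree of \<open>x\<^sup>t e\<^sub>U\<close>.  If \<open>m \<notin> U\<close>, the only summand of \<open>dh f\<close> that survives is the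
  one that inserts \<open>m\<close>, and it returns the coefficient of \<open>f\<close>.  If \<open>m \<in> U\<close>, the coefficient of
  \<open>dh f\<close> agrees with that of \<open>f\<close> up to the coefficient of \<open>d f\<close> at \<open>U - {m}\<close>; the cycle
  condition is used for this one set only.\<close>

lemma koszul_diff_homotopy:
  fixes f :: "nat set \<Rightarrow> 'k::field mpoly"
  assumes U: "U \<subseteq> {1..n}"
    and f: "\<And>W. W \<subseteq> {1..n} \<Longrightarrow> f W \<in> poly_ring n"
    and const: "Poly_Mapping.lookup (f {}) 0 = 0"
    and cycle: "U \<noteq> {} \<Longrightarrow> koszul_diff n f (U - {Min U}) = 0"
  shows "koszul_diff n (koszul_homotopy f) U = f U"
proof (rule poly_mapping_eqI)
  fix t :: monomial
  let ?h = "koszul_homotopy f"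
  let ?L = "Poly_Mapping.lookup (koszul_diff n ?h U) t"
  have fU: "finite U" using U finite_subset by blast
  consider (outside) "\<not> Poly_Mapping.keys t \<subseteq> {1..n}"
    | (trivial) "Poly_Mapping.keys t \<union> U = {}"
    | (inside) "Poly_Mapping.keys t \<subseteq> {1..n}" "Poly_Mapping.keys t \<union> U \<noteq> {}"
    by blast
  then show "?L = Poly_Mapping.lookup (f U) t"
  proof cases
    case outside
    have "koszul_diff n ?h U \<in> poly_ring n"
      by (rule koszul_diff_poly_ring[OF U koszul_homotopy_poly_ring[OF _ f]])
    then have "?L = 0" using outside unfolding poly_ring_iff by blast
    moreover have "Poly_Mapping.lookup (f U) t = 0" using outside f[OF U] unfolding poly_ring_iff by blast
    ultimately show ?thesis by simp
  next
    case trivial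
    then show ?thesis using const by (simp add: lookup_koszul_diff)
  next
    case inside
    define m where "m = Min (Poly_Mapping.keys t \<union> U)"
    have fin: "finite (Poly_Mapping.keys t \<union> U)" using fU by simp
    have m: "m \<in> Poly_Mapping.keys t \<union> U"
      unfolding m_def using fin inside(2) by (rule Min_in)
    have le: "m \<le> u" if "u \<in> Poly_Mapping.keys t \<union> U" for u
      unfolding m_def using fin that by (rule Min_le)
    show ?thesis
    proof (cases "m \<in> U")
      case False
      then have mt: "m \<in> Poly_Mapping.keys t" using m by blast
      then have mA: "m \<in> {1..n} - U" using mt inside(1) False by blast
      have lt: "m < u" if "u \<in> U" for u using le[of u] that False by (cases "m = u") auto
      \<comment> \<open>Inserting another \<open>v\<close> leaves \<open>m\<close> in the monomial, below the least element of the set.\<close>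
      have others: "Poly_Mapping.lookup (?h (insert v U)) (t - exponent v) = 0"
        if v: "v \<in> {1..n} - U" "v \<noteq> m" "v \<in> Poly_Mapping.keys t" for v
      proof -
        have "m < v" using v le[of v] by auto
        then have "m < Min (insert v U)" using lt fU by simp
        moreover have "m \<in> Poly_Mapping.keys (t - exponent v)"
          using keys_minus_exponent(2)[of t v] mt v(2) by blast
        ultimately have "\<not> (\<forall>u\<in>Poly_Mapping.keys (t - exponent v). Min (insert v U) \<le> u)"
          using leD by blast
        then show ?thesis
          by (simp only: koszul_homotopy_def insert_not_empty if_False lookup_least_var_quotient)
      qed
      have "?L = (\<Sum>v\<in>{1..n} - U. if v = m
          then koszul_sign m U * Poly_Mapping.lookup (?h (insert m U)) (t - exponent m) else 0)"
        unfolding lookup_koszul_diff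
      proof (rule sum.cong[OF refl], goal_cases)
        case (1 v)
        then show ?case using others[of v] mt by (cases "v = m") simp_all
      qed
      also have "\<dots> = koszul_sign m U * Poly_Mapping.lookup (?h (insert m U)) (t - exponent m)"
        using mA by (simp only: sum.delta[OF finite_Diff[OF finite_atLeastAtMost]] if_True)
      also have "koszul_sign m U = (1::'k)" using lt by (rule koszul_sign_below)
      also have "?h (insert m U) = least_var_quotient m (f U)"
      proof -
        have "Min (insert m U) = m" using lt fU by (intro Min_eqI) (auto intro: less_imp_le)
        then show ?thesis using False by (simp add: koszul_homotopy_def)
      qed
      also have "Poly_Mapping.lookup \<dots> (t - exponent m) = Poly_Mapping.lookup (f U) t"
      proof -
        have "\<forall>u\<in>Poly_Mapping.keys (t - exponent m). m \<le> u"
          using le keys_minus_exponent(1)[of t m] by blast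
        then show ?thesis
          unfolding lookup_least_var_quotient minus_exponent_add[OF mt] by (rule if_P)
      qed
      finally show ?thesis by simp
    next
      case True
      define V where "V = U - {m}"
      have UV: "U = insert m V" "m \<notin> V" "finite V" using True fU by (auto simp: V_def)
      have Min_U: "Min U = m" using le True fU by (intro Min_eqI) auto
      have m_in: "m \<in> {1..n}" using True U by blast
      have lt: "m < v" if "v \<in> Poly_Mapping.keys t" "v \<notin> U" for v
        using that le[of v] True by (cases "m = v") auto
      \<comment> \<open>Moving \<open>m\<close> from the set to the monomial keeps the multidegree: this is where \<open>d f = 0\<close>
        is evaluated.\<close>
      define s where "s = t + exponent m"
      have ks: "Poly_Mapping.keys s = insert m (Poly_Mapping.keys t)"
        unfolding s_def by (rule keys_add_exponent)
      have h: "Poly_Mapping.lookup (?h (insert v U)) (t - exponent v) =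
          Poly_Mapping.lookup (f (insert v V)) (s - exponent v)"
        if v: "v \<in> {1..n} - U" "v \<in> Poly_Mapping.keys t" for v
      proof -
        have Mv: "Min (insert v U) = m"
          using le True fU v by (intro Min_eqI) auto
        have "insert v U - {m} = insert v V" using v True UV by auto
        then have "?h (insert v U) = least_var_quotient m (f (insert v V))"
          using Mv by (simp add: koszul_homotopy_def)
        moreover have "t - exponent v + exponent m = s - exponent v"
        proof -
          have "s = t - exponent v + exponent m + exponent v"
            unfolding s_def by (subst minus_exponent_add[OF v(2), symmetric]) (simp only: ac_simps)
          then show ?thesis by (simp only: add_diff_cancel_right')
        qed
        moreover have "\<forall>u\<in>Poly_Mapping.keys (t - exponent v). m \<le> u"
          using le keys_minus_exponent(1)[of t v] by blast
        ultimately show ?thesis by (simp add: lookup_least_var_quotient)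
      qed
      \<comment> \<open>\<open>m\<close> is below \<open>v\<close>, so it changes the sign at \<open>v\<close>.\<close>
      have sg: "koszul_sign v U = - (koszul_sign v V :: 'k)"
        if v: "v \<in> {1..n} - U" "v \<in> Poly_Mapping.keys t" for v
        using lt[of v] v by (simp add: UV(1) koszul_sign_insert[OF UV(3,2)])
      let ?S = "\<Sum>v\<in>{1..n} - U. koszul_sign v V *
        (if v \<in> Poly_Mapping.keys s then Poly_Mapping.lookup (f (insert v V)) (s - exponent v) else 0)"
      have "?L = - ?S"
        unfolding lookup_koszul_diff sum_negf[symmetric] using h sg ks True by (intro sum.cong) auto
      moreover have "0 = Poly_Mapping.lookup (f U) t + ?S"
      proof -
        have "koszul_diff n f V = 0" using cycle True Min_U V_def by auto
        then have "0 = Poly_Mapping.lookup (koszul_diff n f V) s" by simp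
        also have "\<dots> = koszul_sign m V * Poly_Mapping.lookup (f (insert m V)) (s - exponent m) + ?S"
        proof -
          have eq: "{1..n} - U = {1..n} - V - {m}" using UV by auto
          show ?thesis
            unfolding lookup_koszul_diff eq using UV(2) m_in ks
            by (subst sum.remove[of _ m]) simp_all
        qed
        also have "koszul_sign m V = (1::'k)"
        proof (rule koszul_sign_below)
          fix u assume "u \<in> V"
          then show "m < u" using le[of u] UV by (cases "m = u") auto
        qed
        also have "s - exponent m = t" by (simp add: s_def)
        finally show ?thesis by (simp add: UV(1))
      qed
      ultimately show ?thesis by (simp add: add_eq_0_iff)
    qed
  qed
qed

section \<open>The Koszul complex in matrix form\<close>

definition face :: "nat \<Rightarrow> nat \<Rightarrow> nat \<Rightarrow> nat set" where
  "face n i = (SOME b. bij_betw b {..<n choose i} {W. W \<subseteq> {1..n} \<and> card W = i})"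

text \<open>At most one summand is nonzero.  Writing the entry as a sum over the inserted vertex makes the
  matrix product match the sum in \<open>koszul_diff\<close> after one exchange of summations.\<close>

definition koszul_matrix :: "nat \<Rightarrow> nat \<Rightarrow> nat \<Rightarrow> nat \<Rightarrow> 'k::field mpoly" where
  "koszul_matrix n i a c =
     (\<Sum>v\<in>{1..n} - face n i a.
        if face n (Suc i) c = insert v (face n i a) then koszul_sign v (face n i a) * var v else 0)"

text \<open>The set-indexed chain with coordinate vector \<open>f\<close>, extended by zero to the sets that are not
  \<open>i\<close>-subsets of \<open>{1..n}\<close>.\<close>

definition chain :: "nat \<Rightarrow> nat \<Rightarrow> (nat \<Rightarrow> 'k::field mpoly) \<Rightarrow> nat set \<Rightarrow> 'k mpoly" where
  "chain n i f W = (\<Sum>c<n choose i. if face n i c = W then f c else 0)"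

lemma bij_betw_face: "bij_betw (face n i) {..<n choose i} {W. W \<subseteq> {1..n} \<and> card W = i}"
proof -
  have "card {W. W \<subseteq> {1..n} \<and> card W = i} = n choose i"
    using n_subsets[of "{1..n}" i] by simp
  moreover have "finite {W. W \<subseteq> {1..n} \<and> card W = i}" by simp
  ultimately have "\<exists>b. bij_betw b {..<n choose i} {W. W \<subseteq> {1..n} \<and> card W = i}"
    using ex_bij_betw_nat_finite by (metis atLeast0LessThan)
  then show ?thesis unfolding face_def by (rule someI_ex)
qed

lemma face_props: "a < n choose i \<Longrightarrow> face n i a \<subseteq> {1..n} \<and> card (face n i a) = i"
  using bij_betw_face[of n i] bij_betwE by fastforce

lemma face_eq_iff: "a < n choose i \<Longrightarrow> b < n choose i \<Longrightarrow> face n i a = face n i b \<longleftrightarrow> a = b"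
  using bij_betw_face[of n i] by (auto simp: bij_betw_def inj_on_def)

lemma face_surj:
  assumes "W \<subseteq> {1..n}" "card W = i"
  obtains a where "a < n choose i" "W = face n i a"
proof -
  have "W \<in> face n i ` {..<n choose i}"
    using bij_betw_face[of n i] assms unfolding bij_betw_def by simp
  then show ?thesis using that by blast
qed

lemma chain_face: "a < n choose i \<Longrightarrow> chain n i f (face n i a) = f a"
  unfolding chain_def by (subst sum.cong[of _ _ _ "\<lambda>c. if c = a then f c else 0"]) (auto simp: face_eq_iff)

lemma chain_eq_0: "card W \<noteq> i \<Longrightarrow> chain n i f W = 0"
  unfolding chain_def by (rule sum.neutral) (use face_props in auto)

lemma chain_poly_ring: "f \<in> free_module n (n choose i) \<Longrightarrow> chain n i f W \<in> poly_ring n"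
  unfolding chain_def free_module_def by (intro poly_ring_sum) (auto intro: poly_ring_0)

lemma mat_apply_koszul_matrix:
  assumes "a < n choose i"
  shows "mat_apply (n choose i) (n choose Suc i) (koszul_matrix n i) f a =
    koszul_diff n (chain n (Suc i) f) (face n i a)"
proof -
  let ?U = "face n i a"
  have "mat_apply (n choose i) (n choose Suc i) (koszul_matrix n i) f a =
    (\<Sum>c<n choose Suc i. \<Sum>v\<in>{1..n} - ?U.
       if face n (Suc i) c = insert v ?U then koszul_sign v ?U * var v * f c else 0)"
    using assms by (auto simp: mat_apply_def koszul_matrix_def sum_distrib_right intro!: sum.cong)
  also have "\<dots> = (\<Sum>v\<in>{1..n} - ?U. \<Sum>c<n choose Suc i.
       if face n (Suc i) c = insert v ?U then koszul_sign v ?U * var v * f c else 0)"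
    by (rule sum.swap)
  also have "\<dots> = koszul_diff n (chain n (Suc i) f) ?U"
    unfolding koszul_diff_def chain_def
    by (auto simp: sum_distrib_left mult.assoc intro!: sum.cong)
  finally show ?thesis .
qed

lemma koszul_diff_chain_eq_0:
  assumes "U \<subseteq> {1..n}" "Suc (card U) \<noteq> i"
  shows "koszul_diff n (chain n i f) U = 0"
proof -
  have "chain n i f (insert v U) = 0" if "v \<in> {1..n} - U" for v
    using that assms finite_subset[OF assms(1)] by (intro chain_eq_0) simp
  then show ?thesis by (simp add: koszul_diff_def)
qed

lemma mat_apply_koszul_matrix_eq_0_iff:
  "mat_apply (n choose i) (n choose Suc i) (koszul_matrix n i) f = (\<lambda>_. 0) \<longleftrightarrow>
     (\<forall>U\<subseteq>{1..n}. koszul_diff n (chain n (Suc i) f) U = 0)" (is "?l = (\<lambda>_. 0) \<longleftrightarrow> ?R")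
proof
  assume l: "?l = (\<lambda>_. 0)"
  show ?R
  proof (intro allI impI)
    fix U :: "nat set" assume U: "U \<subseteq> {1..n}"
    show "koszul_diff n (chain n (Suc i) f) U = 0"
    proof (cases "card U = i")
      case True
      obtain a where "a < n choose i" "U = face n i a" by (rule face_surj[OF U True])
      then show ?thesis using l mat_apply_koszul_matrix[of a n i f] by simp
    next
      case False
      then show ?thesis by (simp add: koszul_diff_chain_eq_0[OF U])
    qed
  qed
next
  assume R: ?R
  show "?l = (\<lambda>_. 0)"
  proof
    fix a
    show "?l a = 0"
      using R face_props[of a n i] mat_apply_koszul_matrix[of a n i f]
      by (cases "a < n choose i") (auto simp: mat_apply_def)
  qed
qed

text \<open>Exactness for all homological degrees in one statement.  The kernel condition for \<open>i > 0\<close> is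
  that \<open>f\<close> is a cycle, the chain of \<open>f\<close> being zero at the empty set; for \<open>i = 0\<close> it is that the
  augmentation sends \<open>f\<close> to \<open>0\<close> in the residue field, the differential of a chain in degree zero
  being zero.\<close>

lemma image_koszul_matrix:
  "mat_apply (n choose i) (n choose Suc i) (koszul_matrix n i) ` free_module n (n choose Suc i) =
   {f \<in> free_module n (n choose i). Poly_Mapping.lookup (chain n i f {}) 0 = 0 \<and>
      (\<forall>U\<subseteq>{1..n}. koszul_diff n (chain n i f) U = 0)}" (is "?D ` _ = ?Z")
proof (intro equalityI subsetI)
  fix f :: "nat \<Rightarrow> 'a mpoly"
  assume "f \<in> ?D ` free_module n (n choose Suc i)"
  then obtain g where g: "g \<in> free_module n (n choose Suc i)" and fg: "f = ?D g" by blast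
  let ?G = "chain n (Suc i) g"
  have fa: "f a = koszul_diff n ?G (face n i a)" if "a < n choose i" for a
    using that by (simp add: fg mat_apply_koszul_matrix)
  have cf: "chain n i f W = koszul_diff n ?G W" if W: "W \<subseteq> {1..n}" for W
  proof (cases "card W = i")
    case True
    obtain a where "a < n choose i" "W = face n i a" by (rule face_surj[OF W True])
    then show ?thesis by (simp add: fa chain_face)
  next
    case False
    then show ?thesis by (simp add: chain_eq_0 koszul_diff_chain_eq_0[OF W])
  qed
  have "koszul_diff n (chain n i f) U = 0" if "U \<subseteq> {1..n}" for U
  proof -
    have "koszul_diff n (chain n i f) U = koszul_diff n (koszul_diff n ?G) U"
      by (rule koszul_diff_cong) (use that cf in auto)
    then show ?thesis by (simp add: koszul_diff_diff[OF that])
  qed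
  moreover have "Poly_Mapping.lookup (chain n i f {}) 0 = 0"
    by (simp add: cf koszul_diff_def lookup_sum lookup_koszul_sign_times lookup_var_times)
  moreover have "f \<in> free_module n (n choose i)"
  proof -
    have "f a \<in> poly_ring n" if "a < n choose i" for a
      unfolding fa[OF that] using face_props[OF that] chain_poly_ring[OF g]
      by (blast intro: koszul_diff_poly_ring)
    moreover have "f a = 0" if "a \<ge> n choose i" for a
      using that fg by (simp add: mat_apply_def)
    ultimately show ?thesis by (simp add: free_module_def)
  qed
  ultimately show "f \<in> ?Z" by blast
next
  fix f :: "nat \<Rightarrow> 'a mpoly"
  assume f: "f \<in> ?Z"
  let ?F = "chain n i f"
  define g where "g c = (if c < n choose Suc i then koszul_homotopy ?F (face n (Suc i) c) else 0)" for c
  have F: "?F W \<in> poly_ring n" for W using f by (simp add: chain_poly_ring)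
  have g: "g \<in> free_module n (n choose Suc i)"
    unfolding free_module_def
  proof (intro CollectI conjI allI impI)
    fix c assume "c < n choose Suc i"
    then show "g c \<in> poly_ring n"
      using koszul_homotopy_poly_ring[OF conjunct1[OF face_props] F] by (simp add: g_def)
  qed (simp add: g_def)
  have cg: "chain n (Suc i) g W = koszul_homotopy ?F W" if W: "W \<subseteq> {1..n}" "card W = Suc i" for W
  proof -
    obtain c where "c < n choose Suc i" "W = face n (Suc i) c" by (rule face_surj[OF W])
    then show ?thesis by (simp add: chain_face g_def)
  qed
  have "f a = ?D g a" for a
  proof (cases "a < n choose i")
    case True
    let ?U = "face n i a"
    have U: "?U \<subseteq> {1..n}" "card ?U = i" using face_props[OF True] by auto
    have "?D g a = koszul_diff n (chain n (Suc i) g) ?U" by (rule mat_apply_koszul_matrix[OF True])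
    also have "\<dots> = koszul_diff n (koszul_homotopy ?F) ?U"
    proof (rule koszul_diff_cong, rule cg)
      fix v assume v: "v \<in> {1..n} - ?U"
      then show "insert v ?U \<subseteq> {1..n}" using U by blast
      show "card (insert v ?U) = Suc i" using v U finite_subset[OF U(1)] by simp
    qed
    also have "\<dots> = ?F ?U"
    proof (rule koszul_diff_homotopy[OF U(1) F])
      show "koszul_diff n ?F (?U - {Min ?U}) = 0"
        using f U(1) by (simp add: subset_insertI2 Diff_subset[THEN subset_trans])
    qed (use f in simp)
    finally show ?thesis using True by (simp add: chain_face)
  next
    case False
    then show ?thesis using f by (simp add: free_module_def mat_apply_def)
  qed
  then show "f \<in> ?D ` free_module n (n choose Suc i)" using g by blast
qed

section \<open>The residue field has regularity zero\<close>

definition maximal_ideal :: "nat \<Rightarrow> 'k::field mpoly set" where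
  "maximal_ideal n = {p \<in> poly_ring n. Poly_Mapping.lookup p 0 = 0}"

lemma face_0: "face n 0 0 = {}"
  using face_props[of 0 n 0] finite_subset by fastforce

lemma koszul_resolution:
  "minimal_graded_free_resolution n (maximal_ideal n :: 'k::field mpoly set)
     (\<lambda>i. n choose i) (\<lambda>i _. int i) (\<lambda>_. 1) (koszul_matrix n)"
proof
  fix a
  show "1 \<in> poly_ring n \<and> homogeneous (int 0) (1 :: 'k mpoly)"
    by (simp add: poly_ring_1 homogeneous_def monomial_degree_def)
next
  fix a b i
  show "koszul_matrix n i a b \<in> poly_ring n \<and>
      homogeneous (int (Suc i) - int i) (koszul_matrix n i a b :: 'k mpoly)"
    unfolding koszul_matrix_def
    by (auto intro!: poly_ring_sum homogeneous_sum koszul_sign_times_poly_ring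
        koszul_sign_times_homogeneous homogeneous_var poly_ring_0 homogeneous_0
        var_in_poly_ring[unfolded atLeastAtMost_iff])
  show "Poly_Mapping.lookup (koszul_matrix n i a b :: 'k mpoly) 0 = 0"
    unfolding koszul_matrix_def lookup_sum
    by (rule sum.neutral) (simp add: lookup_koszul_sign_times lookup_var_0)
next
  fix s :: "'k mpoly" assume "s \<in> poly_ring n"
  then show "\<exists>f\<in>free_module n (n choose 0). s - (\<Sum>a<n choose 0. f a * 1) \<in> maximal_ideal n"
    by (intro bexI[of _ "\<lambda>a. if a = 0 then s else 0"])
      (auto simp: free_module_def maximal_ideal_def poly_ring_0)
next
  have "(\<Sum>a<n choose 0. f a * 1) \<in> maximal_ideal n \<longleftrightarrow>
      Poly_Mapping.lookup (chain n 0 f {}) 0 = 0 \<and> (\<forall>U\<subseteq>{1..n}. koszul_diff n (chain n 0 f) U = 0)"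
    if f: "f \<in> free_module n (n choose 0)" for f :: "nat \<Rightarrow> 'k mpoly"
  proof -
    have "chain n 0 f {} = f 0" using chain_face[of 0 n 0 f] by (simp add: face_0)
    then show ?thesis
      using f by (auto simp: maximal_ideal_def free_module_def koszul_diff_chain_eq_0)
  qed
  then show "{f \<in> free_module n (n choose 0). (\<Sum>a<n choose 0. f a * 1) \<in> (maximal_ideal n :: 'k mpoly set)} =
      mat_apply (n choose 0) (n choose 1) (koszul_matrix n 0) ` free_module n (n choose 1)"
    unfolding One_nat_def image_koszul_matrix by blast
next
  fix i
  show "{f \<in> free_module n (n choose Suc i).
        mat_apply (n choose i) (n choose Suc i) (koszul_matrix n i) f = (\<lambda>_. 0 :: 'k mpoly)} =
      mat_apply (n choose Suc i) (n choose Suc (Suc i)) (koszul_matrix n (Suc i)) `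
        free_module n (n choose Suc (Suc i))"
    unfolding image_koszul_matrix mat_apply_koszul_matrix_eq_0_iff by (simp add: chain_eq_0)
qed

lemma has_regularity_maximal_ideal: "has_regularity n (maximal_ideal n) 0"
proof -
  have "\<exists>i a. a < n choose i \<and> int i - int i = 0" by (intro exI[of _ 0]) simp
  then show ?thesis unfolding has_regularity_def using koszul_resolution[of n] by fastforce
qed

text \<open>A polynomial is regarded as a chain in degree zero.  Then \<open>p = d (h p)\<close> is the required
  combination: every monomial is divided by its least variable.\<close>

lemma maximal_ideal_decomposition:
  fixes p :: "'k::field mpoly"
  assumes "p \<in> maximal_ideal n"
  obtains q where "\<And>v. q v \<in> poly_ring n" "p = (\<Sum>v\<in>{1..n}. q v * var v)"
proof -
  \<comment> \<open>Only the value at the empty set enters, so the chain may as well be constant.\<close>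
  let ?f = "\<lambda>W :: nat set. p"
  have p: "p \<in> poly_ring n" "Poly_Mapping.lookup p 0 = 0"
    using assms by (auto simp: maximal_ideal_def)
  have "koszul_diff n (koszul_homotopy ?f) {} = p"
    by (rule koszul_diff_homotopy) (use p in auto)
  then have eq: "p = (\<Sum>v\<in>{1..n}. koszul_homotopy ?f {v} * var v)"
    by (simp add: koszul_diff_def koszul_sign_def mult.commute)
  show ?thesis
  proof (rule that)
    show "(if v \<in> {1..n} then koszul_homotopy ?f {v} else 0) \<in> poly_ring n" for v
      using p koszul_homotopy_poly_ring[of "{v}" n ?f] by (auto simp: poly_ring_0)
    show "p = (\<Sum>v\<in>{1..n}. (if v \<in> {1..n} then koszul_homotopy ?f {v} else 0) * var v)"
      using eq by simp
  qed
qed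

section \<open>Complete graphs with a pendant edge at each vertex\<close>

definition whiskered_clique :: "nat \<Rightarrow> edges" where
  "whiskered_clique m =
     {{i, j} | i j. i \<in> {1..m} \<and> j \<in> {1..m} \<and> i \<noteq> j} \<union> {{i, m + i} | i. i \<in> {1..m}}"

lemma whiskered_clique_edge_iff:
  "{i, j} \<in> whiskered_clique m \<longleftrightarrow>
     i \<in> {1..m} \<and> j \<in> {1..m} \<and> i \<noteq> j \<or> i \<in> {1..m} \<and> j = m + i \<or> j \<in> {1..m} \<and> i = m + j"
  (is "_ \<longleftrightarrow> ?R")
proof
  assume "{i, j} \<in> whiskered_clique m"
  then show ?R by (auto simp: whiskered_clique_def doubleton_eq_iff)
next
  assume ?R
  then show "{i, j} \<in> whiskered_clique m"
    unfolding whiskered_clique_def using insert_commute[of i j "{}"] by blast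
qed

lemma neighbors_clique_vertex:
  "i \<in> {1..m} \<Longrightarrow> neighbors (whiskered_clique m) i = insert (m + i) ({1..m} - {i})"
  by (auto simp: neighbors_def whiskered_clique_edge_iff)

lemma neighbors_leaf:
  "i \<in> {1..m} \<Longrightarrow> neighbors (whiskered_clique m) (m + i) = {i}"
  by (auto simp: neighbors_def whiskered_clique_edge_iff)

lemma whiskered_clique_vertex_cases:
  fixes v m :: nat
  assumes "v \<in> {1..2 * m}"
  obtains "v \<in> {1..m}" | i where "i \<in> {1..m}" "v = m + i"
proof (cases "v \<le> m")
  case False
  then have "v - m \<in> {1..m}" "v = m + (v - m)" using assms by auto
  then show ?thesis using that by blast
qed (use assms that in auto)

lemma simple_whiskered_clique: "simple_graph (2 * m) (whiskered_clique m)"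
  by (auto simp: simple_graph_def whiskered_clique_def)

lemma whiskered_clique_no_isolated:
  assumes "i \<in> {1..2 * m}"
  shows "neighbors (whiskered_clique m) i \<noteq> {}"
  using assms by (cases rule: whiskered_clique_vertex_cases)
    (simp_all only: neighbors_clique_vertex neighbors_leaf insert_not_empty not_False_eq_True)

lemma connected_whiskered_clique:
  assumes "m > 0"
  shows "connected_graph (2 * m) (whiskered_clique m)"
proof -
  let ?R = "{(a, b). {a, b} \<in> whiskered_clique m}"
  have "sym ?R" by (auto simp: sym_def insert_commute)
  then have sym: "sym (?R\<^sup>*)" by (rule sym_rtrancl)
  have leaf: "(m + i, i) \<in> ?R" if "i \<in> {1..m}" for i
    using that by (simp add: whiskered_clique_edge_iff)
  have to_1: "(u, 1) \<in> ?R\<^sup>*" if u: "u \<in> {1..m}" for u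
  proof (cases "u = 1")
    case False
    then have "(u, 1) \<in> ?R" using u assms by (simp add: whiskered_clique_edge_iff)
    then show ?thesis by (rule r_into_rtrancl)
  qed simp
  have "(u, 1) \<in> ?R\<^sup>*" if "u \<in> {1..2 * m}" for u
    using that
  proof (cases rule: whiskered_clique_vertex_cases)
    case 1
    then show ?thesis by (rule to_1)
  next
    case (2 i)
    have "(m + i, 1) \<in> ?R\<^sup>*"
      by (rule converse_rtrancl_into_rtrancl[OF leaf[OF 2(1)] to_1[OF 2(1)]])
    then show ?thesis unfolding 2(2) .
  qed
  then have "(u, v) \<in> ?R\<^sup>*" if "u \<in> {1..2 * m}" "v \<in> {1..2 * m}" for u v
    using that rtrancl_trans[OF _ symD[OF sym]] by blast
  then show ?thesis using assms unfolding connected_graph_def by simp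
qed

text \<open>A vertex of a cycle has two distinct neighbors on the cycle, so it is no leaf.  The second and
  the fourth vertex are then both in the clique, and they are not consecutive on a cycle of length
  at least four.\<close>

lemma chordal_whiskered_clique: "chordal (whiskered_clique m)"
  unfolding chordal_def
proof (intro allI impI, elim conjE)
  let ?E = "whiskered_clique m"
  fix vs assume cyc: "is_cycle ?E vs" and len: "length vs \<ge> 4"
  have dist: "distinct vs" and edge: "\<And>i. i < length vs \<Longrightarrow> {vs ! i, vs ! (Suc i mod length vs)} \<in> ?E"
    using cyc by (auto simp: is_cycle_def)
  have clique: "vs ! j \<in> {1..m}"
    if "i < length vs" "j < length vs" "j = Suc i mod length vs" "i \<noteq> Suc j mod length vs" for i j
  proof (rule ccontr)
    assume neg: "vs ! j \<notin> {1..m}"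
    let ?k = "Suc j mod length vs"
    have "{vs ! i, vs ! j} \<in> ?E" "{vs ! j, vs ! ?k} \<in> ?E"
      using edge that by auto
    then have n: "vs ! i \<in> neighbors ?E (vs ! j)" "vs ! ?k \<in> neighbors ?E (vs ! j)"
      by (auto simp: neighbors_def insert_commute)
    then have "vs ! j \<in> {1..2 * m}"
      using simple_whiskered_clique[of m] unfolding simple_graph_def neighbors_def by blast
    then obtain w where "neighbors ?E (vs ! j) = {w}"
      using neg by (cases rule: whiskered_clique_vertex_cases) (auto simp only: neighbors_leaf)
    then have "vs ! i = vs ! ?k" using n by simp
    moreover have "?k < length vs" using that(1) by (cases vs) simp_all
    ultimately show False using nth_eq_iff_index_eq[OF dist that(1)] that(4) by blast
  qed
  have wrap: "4 mod length vs \<noteq> 1" "4 mod length vs \<noteq> 2"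
    using len by (cases "length vs = 4"; simp)+
  have succ: "Suc 0 mod length vs = 1" "Suc 1 mod length vs = 2"
    "Suc 2 mod length vs = 3" "Suc 3 mod length vs = 4 mod length vs"
    using len by simp_all
  have pos: "0 < length vs" "1 < length vs" "2 < length vs" "3 < length vs" using len by linarith+
  have "vs ! 1 \<in> {1..m}"
    by (rule clique[OF pos(1,2)]) (simp_all add: succ[simplified])
  moreover have "vs ! 3 \<in> {1..m}"
    by (rule clique[OF pos(3,4)]) (simp_all only: succ wrap not_sym[OF wrap(2)] not_False_eq_True)
  moreover have "vs ! 1 \<noteq> vs ! 3" using dist len by (simp add: nth_eq_iff_index_eq)
  ultimately have "{vs ! 1, vs ! 3} \<in> ?E" unfolding whiskered_clique_edge_iff by blast
  then have "1 \<noteq> (3 :: nat) \<and> 3 \<noteq> Suc 1 mod length vs \<and> 1 \<noteq> Suc 3 mod length vs \<and>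
      {vs ! 1, vs ! 3} \<in> ?E"
    unfolding succ using wrap(1) by simp
  then show "has_chord ?E vs" unfolding has_chord_def using pos(2,4) by blast
qed

text \<open>A cover contains an end of each of the \<open>m\<close> pendant edges, and these edges are disjoint.\<close>

lemma vertex_cover_number_whiskered_clique:
  "vertex_cover_number (2 * m) (whiskered_clique m) = m"
  unfolding vertex_cover_number_def
proof (rule Min_eqI)
  let ?E = "whiskered_clique m"
  have "{C. vertex_cover (2 * m) ?E C} \<subseteq> Pow {1..2 * m}" by (auto simp: vertex_cover_def)
  then show "finite (card ` {C. vertex_cover (2 * m) ?E C})" by (simp add: finite_subset)
  have "vertex_cover (2 * m) ?E {1..m}" by (auto simp: vertex_cover_def whiskered_clique_def)
  then show "m \<in> card ` {C. vertex_cover (2 * m) ?E C}"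
    by (intro image_eqI[of _ _ "{1..m}"]) simp_all
  fix c assume "c \<in> card ` {C. vertex_cover (2 * m) ?E C}"
  then obtain C where C: "vertex_cover (2 * m) ?E C" and c: "c = card C" by blast
  have "{i, m + i} \<inter> C \<noteq> {}" if "i \<in> {1..m}" for i
  proof -
    have "{i, m + i} \<in> ?E" using that by (simp add: whiskered_clique_edge_iff)
    then show ?thesis using C unfolding vertex_cover_def by blast
  qed
  then have "\<forall>i\<in>{1..m}. \<exists>x. x \<in> C \<and> x \<in> {i, m + i}" by blast
  then obtain g where g: "\<forall>i\<in>{1..m}. g i \<in> C \<and> g i \<in> {i, m + i}"
    using bchoice[of "{1..m}" "\<lambda>i x. x \<in> C \<and> x \<in> {i, m + i}"] by blast
  have "inj_on g {1..m}"
  proof (rule inj_onI)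
    fix i j assume "i \<in> {1..m}" "j \<in> {1..m}" "g i = g j"
    then show "i = j" using bspec[OF g, of i] bspec[OF g, of j] by auto
  qed
  moreover have "g ` {1..m} \<subseteq> C" using g by blast
  moreover have "finite C" using C finite_subset by (auto simp: vertex_cover_def)
  ultimately have "card {1..m} \<le> card C" by (rule card_inj_on_le)
  then show "m \<le> c" using c by simp
qed

section \<open>The neighborhood ideal of the degree vector\<close>

lemma ideal_generated_subset_maximal_ideal:
  assumes "B \<subseteq> maximal_ideal n"
  shows "ideal_generated n B \<subseteq> maximal_ideal n"
proof
  fix p :: "'a mpoly" assume "p \<in> ideal_generated n B"
  then obtain F q where p: "p = (\<Sum>b\<in>F. q b * b)" and F: "F \<subseteq> B" "\<forall>b\<in>F. q b \<in> poly_ring n"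
    unfolding ideal_generated_def by blast
  have "Poly_Mapping.lookup (q b * b) 0 = 0" if "b \<in> F" for b
  proof (rule ccontr)
    assume "Poly_Mapping.lookup (q b * b) 0 \<noteq> 0"
    then have "0 \<in> Poly_Mapping.keys (q b * b)" by (simp add: in_keys_iff)
    then obtain s t where st: "0 = s + t" "t \<in> Poly_Mapping.keys b" using keys_mult by blast
    have "t = 0" using st(1) by (metis add_eq_0_iff_both_eq_0 lookup_add lookup_zero poly_mapping_eqI)
    then show False using st(2) that F assms by (auto simp: maximal_ideal_def in_keys_iff)
  qed
  moreover have "q b * b \<in> poly_ring n" if "b \<in> F" for b
    using that F assms by (intro poly_ring_times) (auto simp: maximal_ideal_def)
  ultimately show "p \<in> maximal_ideal n"
    unfolding p maximal_ideal_def by (auto simp: lookup_sum intro: poly_ring_sum)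
qed

lemma var_prod_in_maximal_ideal:
  assumes "W \<subseteq> {1..n}" "W \<noteq> {}"
  shows "(var_prod W :: 'k::field mpoly) \<in> maximal_ideal n"
proof -
  have fin: "finite W" using assms(1) finite_subset by blast
  have poly: "(var_prod V :: 'k mpoly) \<in> poly_ring n" if "V \<subseteq> W" for V
    using finite_subset[OF that fin] that assms(1) unfolding var_prod_def
    by (induction V rule: finite_induct)
      (auto intro!: poly_ring_1 poly_ring_times var_in_poly_ring[unfolded atLeastAtMost_iff])
  obtain w where "w \<in> W" using assms(2) by blast
  then have "var_prod W = (var w * var_prod (W - {w}) :: 'k mpoly)"
    unfolding var_prod_def using fin by (rule prod.remove[rotated])
  then have "Poly_Mapping.lookup (var_prod W :: 'k mpoly) 0 = 0" by (simp only: lookup_var_times) simp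
  then show ?thesis using poly[OF subset_refl] by (simp add: maximal_ideal_def)
qed

text \<open>Without isolated vertices all degrees are positive, so no generator is the empty product.\<close>

lemma neighborhood_ideal_subset_maximal_ideal:
  assumes G: "simple_graph n E" and iso: "no_isolated_vertices n E"
  shows "neighborhood_ideal n E (vertex_degree E) \<subseteq> maximal_ideal n"
proof
  fix p :: "'a mpoly" assume "p \<in> neighborhood_ideal n E (vertex_degree E)"
  then obtain s where p: "p = sum s {1..n}" and
    s: "\<And>i. i \<in> {1..n} \<Longrightarrow> s i \<in> ideal_generated n
        {var_prod W | W. W \<subseteq> closed_neighborhood E i \<and> card W = vertex_degree E i}"
    unfolding neighborhood_ideal_def by (subst (asm) set_sum_alt) auto
  have "s i \<in> maximal_ideal n" if i: "i \<in> {1..n}" for i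
  proof -
    have N: "neighbors E i \<subseteq> {1..n}" using G by (auto simp: simple_graph_def neighbors_def)
    have "vertex_degree E i \<noteq> 0"
      using iso i finite_subset[OF N] by (auto simp: no_isolated_vertices_def vertex_degree_def)
    then have "{var_prod W | W. W \<subseteq> closed_neighborhood E i \<and> card W = vertex_degree E i}
        \<subseteq> (maximal_ideal n :: 'a mpoly set)"
    proof safe
      fix W assume W: "W \<subseteq> closed_neighborhood E i" "card W = vertex_degree E i"
      have "W \<subseteq> {1..n}" using W(1) N i unfolding closed_neighborhood_def by blast
      moreover have "W \<noteq> {}" using W(2) \<open>vertex_degree E i \<noteq> 0\<close> by auto
      ultimately show "var_prod W \<in> (maximal_ideal n :: 'a mpoly set)"
        by (rule var_prod_in_maximal_ideal)
    qed
    then show ?thesis by (rule subsetD[OF ideal_generated_subset_maximal_ideal s[OF i]])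
  qed
  then show "p \<in> maximal_ideal n"
    unfolding p maximal_ideal_def by (auto simp: lookup_sum intro: poly_ring_sum)
qed

text \<open>The summand of the ideal that belongs to the leaf \<open>m + i\<close> contains \<open>x\<^sub>i\<close> and \<open>x\<^sub>m\<^sub>+\<^sub>i\<close>.  Every
  variable occurs for exactly one leaf, so the terms of \<open>p\<close> can be distributed over the leaves.\<close>

lemma maximal_ideal_subset_neighborhood_ideal:
  "maximal_ideal (2 * m) \<subseteq>
     neighborhood_ideal (2 * m) (whiskered_clique m) (vertex_degree (whiskered_clique m))"
proof
  let ?n = "2 * m" and ?E = "whiskered_clique m"
  fix p :: "'a mpoly" assume "p \<in> maximal_ideal ?n"
  then obtain q where q: "\<And>v. q v \<in> poly_ring ?n" and p: "p = (\<Sum>v\<in>{1..?n}. q v * var v)"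
    by (rule maximal_ideal_decomposition) auto
  define s where "s v = (if v \<le> m then 0 else q v * var v + q (v - m) * var (v - m))" for v
  let ?J = "\<lambda>i. ideal_generated ?n
        {var_prod W | W. W \<subseteq> closed_neighborhood ?E i \<and> card W = vertex_degree ?E i}"
  have "s v \<in> ?J v" if v: "v \<in> {1..?n}" for v
    using v
  proof (cases rule: whiskered_clique_vertex_cases)
    case 1
    then have "s v = 0" by (simp add: s_def)
    moreover have "0 \<in> ?J v" unfolding ideal_generated_def by (force intro: exI[of _ "{}"])
    ultimately show ?thesis by simp
  next
    case (2 i)
    let ?r = "\<lambda>b. if b = var v then q v else q i"
    have nb: "closed_neighborhood ?E v = {v, i}" "vertex_degree ?E v = 1"
      using 2 neighbors_leaf by (simp_all add: closed_neighborhood_def vertex_degree_def)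
    have "v \<noteq> i" using 2 by auto
    then have "var v \<noteq> (var i :: 'a mpoly)"
      by (metis lookup_single_eq lookup_single_not_eq var_def zero_neq_one)
    then have "s v = (\<Sum>b\<in>{var v, var i}. ?r b * b)" using 2 by (simp add: s_def)
    moreover have "{var v, var i} \<subseteq>
        {var_prod W :: 'a mpoly | W. W \<subseteq> closed_neighborhood ?E v \<and> card W = vertex_degree ?E v}"
    proof -
      have "var v = (var_prod {v} :: 'a mpoly)" "var i = (var_prod {i} :: 'a mpoly)"
        by (simp_all add: var_prod_def)
      then show ?thesis unfolding nb by fastforce
    qed
    ultimately show ?thesis
      unfolding ideal_generated_def using q
      by (intro CollectI exI[of _ "{var v, var i}"] exI[of _ ?r]) auto
  qed
  moreover have "p = sum s {1..?n}"
  proof -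
    have split: "sum g {1..?n} = (\<Sum>i\<in>{1..m}. g i + g (i + m))" for g :: "nat \<Rightarrow> 'a mpoly"
      using sum.ub_add_nat[of 1 m g m] sum.shift_bounds_cl_nat_ivl[of g 1 m m]
      by (simp add: mult_2 sum.distrib)
    show ?thesis unfolding p split by (intro sum.cong) (auto simp: s_def)
  qed
  ultimately show "p \<in> neighborhood_ideal ?n ?E (vertex_degree ?E)"
    unfolding neighborhood_ideal_def by (subst set_sum_alt) auto
qed

theorem proposition3p1:
  fixes m :: nat
  assumes "m > 0"
  shows "\<exists>n E. simple_graph n E \<and> connected_graph n E \<and> chordal E \<and> no_isolated_vertices n E \<and>
    has_regularity n (neighborhood_ideal n E (vertex_degree E) :: 'k::field mpoly set)
      (int (vertex_cover_number n E) - int m)"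
proof -
  let ?n = "2 * m" and ?E = "whiskered_clique m"
  have iso: "no_isolated_vertices ?n ?E"
    using whiskered_clique_no_isolated by (simp add: no_isolated_vertices_def)
  have "neighborhood_ideal ?n ?E (vertex_degree ?E) = (maximal_ideal ?n :: 'k mpoly set)"
    using neighborhood_ideal_subset_maximal_ideal[OF simple_whiskered_clique iso]
      maximal_ideal_subset_neighborhood_ideal by blast
  then have "has_regularity ?n (neighborhood_ideal ?n ?E (vertex_degree ?E) :: 'k mpoly set)
      (int (vertex_cover_number ?n ?E) - int m)"
    using has_regularity_maximal_ideal[of ?n]
    by (simp add: vertex_cover_number_whiskered_clique)
  then show ?thesis
    using simple_whiskered_clique connected_whiskered_clique[OF assms] chordal_whiskered_clique iso
    by blast
qed

end
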